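(* Let $G$ be a finite connected graph. Then there exists a non-degenerate labeling $l\colon V(G)\to\mathbb{R}^+$ such that \[ (V(G),d_l)\in\mathbf{GH}, \] where $d_l$ is an ultrametric on $V(G)$ generated by $G(l)$.
   Context: $\mathbb{R}^+:=[0,\infty)$. A graph $G$ is a pair $(V,E)$ with $V=V(G)$ a non-empty set and $E=E(G)$ a (possibly empty) set of unordered pairs of distinct elements of $V$. A graph is finite if it has finitely many vertices. A path is a graph with vertex set $\{x_0,\dots,x_k\}$, all $x_i$ distinct, $k\ge 1$, and edge set $\{\{x_0,x_1\},\dots,\{x_{k-1},x_k\}\}$; it joins $x_0$ and $x_k$. $G$ is connected if any two distinct vertices are joined by a path contained in $G$ (one-vertex graphs are connected). A labeled graph $G(l)$ is a graph $G$ together with a labeling $l\colon V(G)\to\mathbb{R}^+$. The labeling $l$ is non-degenerate if $\max\{l(u),l(v)\}>0$ for each edge $\{u,v\}\in E(G)$. For a connected labeled graph $G(l)$, the mapping $d_l\colon V(G)\times V(G)\to\mathbb{R}^+$ generated by $G(l)$ is \[ d_l(x,y):=\begin{cases}0,& x=y,\\ \inf\limits_{P\in\mathcal{P}_{x,y}}\Big(\max\limits_{v\in V(P)}l(v)\Big),& x\ne y,\end{cases} \] where $\mathcal{P}_{x,y}$ is the set of all paths joining $x$ and $y$ in $G$. An ultrametric on a non-empty set $X$ is a function $d\colon X\times X\to\mathbb{R}^+$ with $d(x,y)=d(y,x)$, $d(x,y)=0\iff x=y$, and $d(x,y)\le\max\{d(x,z),d(z,y)\}$ for all $x,y,z\in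 X$. The distance set of $(X,d)$ is $D(X):=\{d(x,y):x,y\in X\}$ (it contains $0$). $\mathbf{GH}$ denotes the class of all finite ultrametric spaces $(X,d)$ with $|D(X)|=|X|$. *)

theory Defs
  imports Complex_Main
begin

record 'a ugraph =
  vertices :: "'a set"
  edges :: "'a set set"

definition is_graph :: "'a ugraph \<Rightarrow> bool" where
  "is_graph G \<longleftrightarrow> vertices G \<noteq> {} \<and>
     edges G \<subseteq> {{u, v} |u v. u \<in> vertices G \<and> v \<in> vertices G \<and> u \<noteq> v}"

definition finite_graph :: "'a ugraph \<Rightarrow> bool" where
  "finite_graph G \<longleftrightarrow> is_graph G \<and> finite (vertices G)"

definition subgraph :: "'a ugraph \<Rightarrow> 'a ugraph \<Rightarrow> bool" where
  "subgraph H G \<longleftrightarrow> is_graph H \<and> vertices H \<subseteq> vertices G \<and> edges H \<subseteq> edges G"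

(* A path is a graph, not a vertex list; xs enumerates x_0, ..., x_k, and 2 <= length xs is k >= 1. *)
definition path_joining :: "'a ugraph \<Rightarrow> 'a \<Rightarrow> 'a \<Rightarrow> bool" where
  "path_joining P x y \<longleftrightarrow>
     (\<exists>xs. distinct xs \<and> 2 \<le> length xs \<and>
           vertices P = set xs \<and>
           edges P = {{xs ! i, xs ! Suc i} |i. Suc i < length xs} \<and>
           x = hd xs \<and> y = last xs)"

definition paths_in :: "'a ugraph \<Rightarrow> 'a \<Rightarrow> 'a \<Rightarrow> 'a ugraph set" where
  "paths_in G x y = {P. path_joining P x y \<and> subgraph P G}"

definition connected_graph :: "'a ugraph \<Rightarrow> bool" where
  "connected_graph G \<longleftrightarrow> is_graph G \<and>
     (\<forall>x\<in>vertices G. \<forall>y\<in>vertices G. x \<noteq> y \<longrightarrow> paths_in G x y \<noteq> {})"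

(* Labelings are total functions; their values off the vertex set are irrelevant. *)
definition labeling :: "'a ugraph \<Rightarrow> ('a \<Rightarrow> real) \<Rightarrow> bool" where
  "labeling G l \<longleftrightarrow> (\<forall>v\<in>vertices G. 0 \<le> l v)"

definition nondegenerate :: "'a ugraph \<Rightarrow> ('a \<Rightarrow> real) \<Rightarrow> bool" where
  "nondegenerate G l \<longleftrightarrow> (\<forall>u v. {u, v} \<in> edges G \<longrightarrow> max (l u) (l v) > 0)"

(* Meaningful for x, y in a connected G, where the infimum ranges over a non-empty set
   bounded below by 0 (the real Inf of the empty set is an arbitrary value). *)
definition gen_dist :: "'a ugraph \<Rightarrow> ('a \<Rightarrow> real) \<Rightarrow> 'a \<Rightarrow> 'a \<Rightarrow> real" where
  "gen_dist G l x y =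
     (if x = y then 0 else (INF P\<in>paths_in G x y. Max (l ` vertices P)))"

(* The locale Metric_space of HOL-Analysis is not used: it requires nonnegativity and
   symmetry on the whole type, whereas gen_dist is only determined on the vertex set. *)
definition ultrametric_on :: "'a set \<Rightarrow> ('a \<Rightarrow> 'a \<Rightarrow> real) \<Rightarrow> bool" where
  "ultrametric_on X d \<longleftrightarrow> X \<noteq> {} \<and>
     (\<forall>x\<in>X. \<forall>y\<in>X. 0 \<le> d x y) \<and>
     (\<forall>x\<in>X. \<forall>y\<in>X. d x y = d y x) \<and>
     (\<forall>x\<in>X. \<forall>y\<in>X. d x y = 0 \<longleftrightarrow> x = y) \<and>
     (\<forall>x\<in>X. \<forall>y\<in>X. \<forall>z\<in>X. d x y \<le> max (d x z) (d z y))"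

definition distance_set :: "'a set \<Rightarrow> ('a \<Rightarrow> 'a \<Rightarrow> real) \<Rightarrow> real set" where
  "distance_set X d = {d x y |x y. x \<in> X \<and> y \<in> X}"

definition GH :: "('a set \<times> ('a \<Rightarrow> 'a \<Rightarrow> real)) set" where
  "GH = {(X, d). finite X \<and> ultrametric_on X d \<and> card (distance_set X d) = card X}"

end

theory Submission
  imports Defs
begin

text \<open>
  Enumerate the vertices as \<open>x\<^sub>0, \<dots>, x\<^sub>n\<close> so that every initial segment induces a connected
  subgraph, and label \<open>x\<^sub>i\<close> by \<open>i\<close>. Two distinct vertices are then joined by a path inside the
  initial segment ending at the later one, so their distance is the larger of their two labels,
  and the nonzero distances are exactly \<open>1, \<dots>, n\<close>.
\<close>

text \<open>Vertex-list form of a path, suited to consing and reversal. Unlike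
  \<open>path_joining\<close> it admits the one-vertex list, so the case of equal endpoints needs no
  separate treatment in the induction below.\<close>

definition path_list :: "'a ugraph \<Rightarrow> 'a \<Rightarrow> 'a list \<Rightarrow> 'a \<Rightarrow> bool" where
  "path_list G x xs y \<longleftrightarrow> xs \<noteq> [] \<and> hd xs = x \<and> last xs = y \<and> distinct xs \<and>
     set xs \<subseteq> vertices G \<and> successively (\<lambda>u v. {u, v} \<in> edges G) xs"

lemma path_list_rev: "path_list G x xs y \<Longrightarrow> path_list G y (rev xs) x"
  by (auto simp: path_list_def hd_rev last_rev insert_commute)

lemma path_list_singleton: "x \<in> vertices G \<Longrightarrow> path_list G x [x] x"
  by (simp add: path_list_def)

lemma path_list_Cons:
  assumes "path_list G x xs y" "{w, x} \<in> edges G" "w \<in> vertices G" "w \<notin> set xs"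
  shows "path_list G w (w # xs) y"
  using assms by (auto simp: path_list_def successively_Cons)

lemma path_list_endpoints: "path_list G x xs y \<Longrightarrow> x \<in> set xs \<and> y \<in> set xs"
  by (auto simp: path_list_def)

lemma path_list_imp_paths_in:
  assumes "path_list G x xs y" "x \<noteq> y"
  obtains P where "P \<in> paths_in G x y" "vertices P = set xs"
proof -
  let ?P = "\<lparr>vertices = set xs, edges = {{xs ! i, xs ! Suc i} |i. Suc i < length xs}\<rparr>"
  have xs: "xs \<noteq> []" "hd xs = x" "last xs = y" "distinct xs" "set xs \<subseteq> vertices G"
    and succ: "\<And>i. Suc i < length xs \<Longrightarrow> {xs ! i, xs ! Suc i} \<in> edges G"
    using assms(1) by (auto simp: path_list_def successively_conv_nth)
  \<comment> \<open>Distinct endpoints exclude the one-vertex list, which is not a path in the sense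
    of \<open>path_joining\<close>.\<close>
  have "2 \<le> length xs"
    using xs(1-3) assms(2) by (cases xs rule: list.exhaust[case_product list.exhaust])
      (auto simp: Suc_le_eq split: if_splits)
  then have "path_joining ?P x y"
    unfolding path_joining_def using xs by (intro exI[of _ xs]) auto
  moreover have "is_graph ?P"
    unfolding is_graph_def
  proof (intro conjI subsetI)
    fix e assume "e \<in> edges ?P"
    then obtain i where i: "Suc i < length xs" "e = {xs ! i, xs ! Suc i}" by auto
    with \<open>distinct xs\<close> have "xs ! i \<noteq> xs ! Suc i" by (simp add: nth_eq_iff_index_eq)
    with i show "e \<in> {{u, v} |u v. u \<in> vertices ?P \<and> v \<in> vertices ?P \<and> u \<noteq> v}"
      by simp (metis Suc_lessD nth_mem)
  qed (use xs in auto)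
  ultimately have "?P \<in> paths_in G x y"
    using xs succ by (auto simp: paths_in_def subgraph_def)
  then show ?thesis by (rule that) simp
qed

lemma paths_in_imp_path_list:
  assumes "P \<in> paths_in G x y"
  obtains xs where "path_list G x xs y" "vertices P = set xs"
proof -
  obtain xs where xs: "distinct xs" "2 \<le> length xs" "vertices P = set xs"
    "edges P = {{xs ! i, xs ! Suc i} |i. Suc i < length xs}" "x = hd xs" "y = last xs"
    using assms by (auto simp: paths_in_def path_joining_def)
  moreover have "vertices P \<subseteq> vertices G" "edges P \<subseteq> edges G"
    using assms by (auto simp: paths_in_def subgraph_def)
  ultimately have "path_list G x xs y"
    by (auto simp: path_list_def successively_conv_nth)
  with xs show ?thesis by (intro that) auto
qed

text \<open>Discrete crossing argument: walking along the list, the first step that leaves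
  \<open>S\<close> provides \<open>u\<close> and \<open>w\<close>.\<close>

lemma successively_leaves_set:
  assumes "successively R xs" "xs \<noteq> []" "hd xs \<in> S" "last xs \<notin> S"
  obtains u w where "u \<in> S" "w \<in> set xs" "w \<notin> S" "R u w"
proof -
  have "\<exists>u w. u \<in> S \<and> w \<in> set xs \<and> w \<notin> S \<and> R u w"
    using assms
  proof (induction xs)
    case (Cons a xs)
    then have "xs \<noteq> []" by auto
    with Cons.prems have xs: "xs \<noteq> []" "successively R xs" "R a (hd xs)" "a \<in> S" "last xs \<notin> S"
      by (auto simp: successively_Cons)
    then show ?case
      using Cons.IH by (cases "hd xs \<in> S") (auto intro: hd_in_set)
  qed simp
  then show ?thesis using that by blast
qed

text \<open>A path from inside \<open>S\<close> to outside must cross the boundary of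
  \<open>S\<close>. The outer end \<open>w\<close> of the crossing edge is the next vertex of the
  enumeration.\<close>

lemma connected_graph_boundary_edge:
  assumes "connected_graph G" "S \<subset> vertices G" "S \<noteq> {}"
  obtains u w where "u \<in> S" "w \<in> vertices G - S" "{w, u} \<in> edges G"
proof -
  obtain s t where st: "s \<in> S" "t \<in> vertices G - S" using assms(2,3) by blast
  then have "s \<in> vertices G" "t \<in> vertices G" "s \<noteq> t" using assms(2) by auto
  with assms(1) obtain P where "P \<in> paths_in G s t"
    unfolding connected_graph_def by (meson all_not_in_conv)
  then obtain xs where xs: "path_list G s xs t" by (rule paths_in_imp_path_list)
  then have "successively (\<lambda>u v. {u, v} \<in> edges G) xs" "xs \<noteq> []" "hd xs \<in> S" "last xs \<notin> S"
    using st by (auto simp: path_list_def)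
  then obtain u w where "u \<in> S" "w \<in> set xs" "w \<notin> S" "{u, w} \<in> edges G"
    by (rule successively_leaves_set)
  moreover from this xs have "w \<in> vertices G" by (auto simp: path_list_def)
  ultimately show ?thesis by (intro that[of u w]) (auto simp: insert_commute)
qed

lemma connected_initial_segment:
  assumes "finite (vertices G)" "connected_graph G" "Suc k \<le> card (vertices G)"
  shows "\<exists>S (f::'a \<Rightarrow> nat). S \<subseteq> vertices G \<and> card S = Suc k \<and> f ` S = {..k} \<and>
    (\<forall>x\<in>S. \<forall>y\<in>S. \<exists>xs. path_list G x xs y \<and> set xs \<subseteq> S \<and> (\<forall>v\<in>set xs. f v \<le> max (f x) (f y)))"
  using assms(3)
proof (induction k)
  case 0
  then obtain r where "r \<in> vertices G" by fastforce
  then show ?case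
    by (intro exI[of _ "{r}"] exI[of _ "\<lambda>_. 0"])
      (auto intro!: exI[of _ "[r]"] path_list_singleton)
next
  case (Suc k)
  then obtain S and f :: "'a \<Rightarrow> nat" where S: "S \<subseteq> vertices G" "card S = Suc k" "f ` S = {..k}"
    and conn: "\<And>x y. x \<in> S \<Longrightarrow> y \<in> S \<Longrightarrow>
      \<exists>xs. path_list G x xs y \<and> set xs \<subseteq> S \<and> (\<forall>v\<in>set xs. f v \<le> max (f x) (f y))"
    by fastforce
  have fin: "finite S" and "S \<noteq> {}" using S(2) by (auto intro: card_ge_0_finite)
  have "S \<subset> vertices G" using S Suc.prems by auto
  then obtain u w where "u \<in> S" "w \<in> vertices G - S" "{w, u} \<in> edges G"
    using \<open>S \<noteq> {}\<close> by (rule connected_graph_boundary_edge[OF assms(2)])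
  then have uw: "u \<in> S" "w \<in> vertices G" "w \<notin> S" "{w, u} \<in> edges G" by auto
  \<comment> \<open>The new vertex receives the largest label so far, so the label bound holds
    automatically for every path in \<open>insert w S\<close> with endpoint
    \<open>w\<close>.\<close>
  define g where "g = f(w := Suc k)"
  have g_S: "g x = f x" if "x \<in> S" for x using that uw(3) by (auto simp: g_def)
  have g_w: "g w = Suc k" by (simp add: g_def)
  have g_le: "g x \<le> Suc k" if "x \<in> insert w S" for x
    using that S(3) g_S g_w by (auto simp: le_Suc_eq)
  \<comment> \<open>Enter \<open>S\<close> through the boundary edge to \<open>u\<close>, then
    follow an old path; \<open>w\<close> is not on it because it stays in \<open>S\<close>.\<close>
  have from_w: "\<exists>xs. path_list G w xs y \<and> set xs \<subseteq> insert w S" if y: "y \<in> S" for y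
  proof -
    obtain xs where "path_list G u xs y" "set xs \<subseteq> S" using conn[OF uw(1) y] by blast
    with uw have "path_list G w (w # xs) y \<and> set (w # xs) \<subseteq> insert w S"
      by (auto intro!: path_list_Cons)
    then show ?thesis by blast
  qed
  have "\<exists>xs. path_list G x xs y \<and> set xs \<subseteq> insert w S \<and> (\<forall>v\<in>set xs. g v \<le> max (g x) (g y))"
    if xy: "x \<in> insert w S" "y \<in> insert w S" for x y
  proof (cases "x = w \<or> y = w")
    case True
    then have "\<exists>xs. path_list G x xs y \<and> set xs \<subseteq> insert w S"
    proof (elim disjE)
      assume "x = w"
      then show ?thesis
        using from_w[of y] path_list_singleton[OF uw(2)] xy by (cases "y = w") force+
    next
      assume "y = w"
      then show ?thesis
        using from_w[of x] path_list_singleton[OF uw(2)] path_list_rev[of G w _ x] xy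
        by (cases "x = w") (force, metis insertE set_rev)
    qed
    \<comment> \<open>One endpoint is \<open>w\<close>, and by \<open>g_le\<close> no label on the
      path exceeds that of \<open>w\<close>.\<close>
    moreover have "max (g x) (g y) = Suc k"
      using True g_w g_le xy by fastforce
    ultimately show ?thesis using g_le by (metis subsetD)
  next
    case False
    then have "x \<in> S" "y \<in> S" using xy by auto
    then obtain xs where xs: "path_list G x xs y" "set xs \<subseteq> S"
      "\<forall>v\<in>set xs. f v \<le> max (f x) (f y)" using conn by blast
    then have "\<forall>v\<in>set xs. g v \<le> max (g x) (g y)"
      using g_S \<open>x \<in> S\<close> \<open>y \<in> S\<close> by (metis subsetD)
    with xs show ?thesis by blast
  qed
  moreover have "g ` insert w S = {..Suc k}"
    using S(3) g_S g_w by (simp add: atMost_Suc)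
  moreover have "card (insert w S) = Suc (Suc k)" using fin S(2) uw(3) by simp
  moreover have "insert w S \<subseteq> vertices G" using S(1) uw(2) by simp
  ultimately show ?case by (intro exI[of _ "insert w S"] exI[of _ g]) blast
qed

text \<open>Every path contains both of its endpoints, so the larger endpoint label is a lower bound
  for all path maxima. The given path attains it, so the infimum is a minimum.\<close>

lemma gen_dist_eq_max_labels:
  assumes "path_list G x xs y" "x \<noteq> y" "\<forall>v\<in>set xs. l v \<le> max (l x) (l y)"
  shows "gen_dist G l x y = max (l x) (l y)"
proof -
  have le: "max (l x) (l y) \<le> Max (l ` vertices P)" if P: "P \<in> paths_in G x y" for P
  proof -
    obtain ys where "path_list G x ys y" "vertices P = set ys"
      using P by (rule paths_in_imp_path_list)
    then show ?thesis using path_list_endpoints[of G x ys y] by auto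
  qed
  obtain P where P: "P \<in> paths_in G x y" "vertices P = set xs"
    using path_list_imp_paths_in[OF assms(1,2)] .
  have "Max (l ` vertices P) \<le> max (l x) (l y)"
    using assms(1,3) P(2) by (intro Max.boundedI) (auto simp: path_list_def)
  with le[OF P(1)] have "Max (l ` vertices P) = max (l x) (l y)" by (rule antisym[rotated])
  with P(1) le have "(INF P\<in>paths_in G x y. Max (l ` vertices P)) = max (l x) (l y)"
    by (intro cInf_eq_minimum) (auto intro: rev_image_eqI)
  with assms(2) show ?thesis by (simp add: gen_dist_def)
qed

text \<open>Injectivity allows at most one label 0, so distinct points have positive distance. For
  the strong triangle inequality with \<open>z\<close> different from \<open>x\<close> and
  \<open>y\<close>, both \<open>l x\<close> and \<open>l y\<close> occur in the maximum on the
  right.\<close>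

lemma ultrametric_on_max_labels:
  fixes d :: "'a \<Rightarrow> 'a \<Rightarrow> real"
  assumes "X \<noteq> {}" "inj_on l X" "\<And>x. x \<in> X \<Longrightarrow> 0 \<le> l x"
    and d: "\<And>x y. x \<in> X \<Longrightarrow> y \<in> X \<Longrightarrow> d x y = (if x = y then 0 else max (l x) (l y))"
  shows "ultrametric_on X d"
proof -
  have "max (l x) (l y) \<noteq> 0" if "x \<in> X" "y \<in> X" "x \<noteq> y" for x y
    using that assms(2) assms(3)[of x] assms(3)[of y] by (auto simp: max_def inj_on_def)
  then show ?thesis
    using assms(1,3) unfolding ultrametric_on_def
    by (auto simp: d max.commute le_max_iff_disj)
qed

text \<open>A maximum of two labels is again a label, and the distance 0 is \<open>l r\<close>.
  Conversely, distances from the zero-labeled point \<open>r\<close> realize every label.\<close>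

lemma distance_set_max_labels:
  fixes d :: "'a \<Rightarrow> 'a \<Rightarrow> real"
  assumes r: "r \<in> X" "l r = 0" and "\<And>x. x \<in> X \<Longrightarrow> 0 \<le> l x"
    and d: "\<And>x y. x \<in> X \<Longrightarrow> y \<in> X \<Longrightarrow> d x y = (if x = y then 0 else max (l x) (l y))"
  shows "distance_set X d = l ` X"
proof
  show "distance_set X d \<subseteq> l ` X"
    using r by (force simp: distance_set_def d max_def)
  have "l x = d r x" if "x \<in> X" for x
    using assms(3)[OF that] that r by (auto simp: d)
  then show "l ` X \<subseteq> distance_set X d"
    using r(1) by (auto simp: distance_set_def)
qed

theorem proposition3p12:
  fixes G :: "'a ugraph"
  assumes "finite_graph G" and "connected_graph G"
  shows "\<exists>l. labeling G l \<and> nondegenerate G l \<and> (vertices G, gen_dist G l) \<in> GH"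
proof -
  let ?V = "vertices G"
  have fin: "finite ?V" and ne: "?V \<noteq> {}" and graph: "is_graph G"
    using assms(1) by (auto simp: finite_graph_def is_graph_def)
  then obtain k where k: "card ?V = Suc k" by (metis card_eq_0_iff not0_implies_Suc)
  obtain S and f :: "'a \<Rightarrow> nat" where "S \<subseteq> ?V" "card S = Suc k" and fS: "f ` S = {..k}"
    and conn: "\<And>x y. x \<in> S \<Longrightarrow> y \<in> S \<Longrightarrow>
      \<exists>xs. path_list G x xs y \<and> (\<forall>v\<in>set xs. f v \<le> max (f x) (f y))"
    using connected_initial_segment[OF fin assms(2), of k] k by (metis order_refl)
  then have S: "S = ?V" using fin k by (simp add: card_subset_eq)
  \<comment> \<open>A map from \<open>Suc k\<close> vertices onto the \<open>Suc k\<close> numbers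
    in \<open>{..k}\<close> is injective.\<close>
  have inj: "inj_on f ?V" using fin k fS S by (intro eq_card_imp_inj_on) auto
  define l where "l = (\<lambda>v. real (f v))"
  have inj_l: "inj_on l ?V" using inj by (auto simp: inj_on_def l_def)
  have l_nonneg: "0 \<le> l v" for v by (simp add: l_def)
  obtain r where r: "r \<in> ?V" "l r = 0" using fS S unfolding l_def by (force simp: set_eq_iff)
  have d: "gen_dist G l x y = (if x = y then 0 else max (l x) (l y))"
    if xy: "x \<in> ?V" "y \<in> ?V" for x y
  proof (cases "x = y")
    case False
    obtain xs where xs: "path_list G x xs y" "\<forall>v\<in>set xs. f v \<le> max (f x) (f y)"
      using conn[of x y] xy S by blast
    then have "\<forall>v\<in>set xs. l v \<le> max (l x) (l y)"
      by (simp add: l_def of_nat_max[symmetric] del: of_nat_max)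
    with xs(1) False show ?thesis by (simp add: gen_dist_eq_max_labels)
  qed (simp add: gen_dist_def)
  have "nondegenerate G l"
    unfolding nondegenerate_def
  proof (intro allI impI)
    fix u v assume "{u, v} \<in> edges G"
    then have "u \<in> ?V" "v \<in> ?V" "u \<noteq> v"
      using graph by (auto simp: is_graph_def doubleton_eq_iff dest!: subsetD)
    \<comment> \<open>Two different nonnegative labels cannot both vanish, so each edge has an end
      with positive label.\<close>
    then have "l u \<noteq> l v" using inj_l by (auto dest: inj_onD)
    then show "max (l u) (l v) > 0" using l_nonneg[of u] l_nonneg[of v] by linarith
  qed
  moreover have "labeling G l" using l_nonneg by (simp add: labeling_def)
  moreover have "ultrametric_on ?V (gen_dist G l)"
    using ne inj_l l_nonneg d by (rule ultrametric_on_max_labels)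
  \<comment> \<open>The distance set is the image of the vertex set under the injective
    \<open>l\<close>.\<close>
  moreover have "card (distance_set ?V (gen_dist G l)) = card ?V"
    using distance_set_max_labels[OF r l_nonneg d] inj_l by (simp add: card_image)
  ultimately show ?thesis using fin by (auto simp: GH_def)
qed

end
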